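(* Let $N=\{1,\dots,n\}$ and let $E,w_1,\dots,w_n$ be positive rational numbers with $E<\sum_{i\in N}w_i$ and $w_i\le E$ for all $i\in N$. Let $\phi=(\phi_1,\dots,\phi_n)$ be the Shapley value of the bankruptcy game $\mathrm{BG}[E;w_1,\dots,w_n]$, let $M$ be a positive integer, and let $(\phi^A_1,\dots,\phi^A_n)$ be the random vector output by the Monte Carlo algorithm with $M$ samples (defined in the context). Then for each player $i\in N$, $\mathbb{E}[\phi^A_i]=\phi_i$. Moreover, for any $\varepsilon>0$ and $0<\delta<1$: (1) if $M\ge\dfrac{n^2\ln(2/\delta)}{2\varepsilon^2}$, then each player $i\in N$ satisfies $\Pr\left[\dfrac{|\phi^A_i-\phi_i|}{\phi_i}<\varepsilon\right]\ge1-\delta$; (2) if $M\ge\dfrac{n^2\ln(2n/\delta)}{2\varepsilon^2}$, then $\Pr\left[\forall i\in N,\ \dfrac{|\phi^A_i-\phi_i|}{\phi_i}<\varepsilon\right]\ge1-\delta$.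
   Context: The bankruptcy game $\mathrm{BG}[E;w_1,\dots,w_n]$ is the cooperative game $(N,v)$ with $v(S)=\max\{0,\,E-\sum_{i\in N\setminus S}w_i\}$ for all $S\subseteq N$. A permutation of $N$ is a bijection $\pi:\{1,\dots,n\}\to N$; $\Pi_N$ is the set of all of them; $\mathrm{Prc}(\pi,i)$ is the set of players preceding $i$ in $\pi$; the marginal contribution is $\delta_v(\pi,i)=v(\mathrm{Prc}(\pi,i)\cup\{i\})-v(\mathrm{Prc}(\pi,i))$. The Shapley value is $\phi_i=\frac{1}{n!}\sum_{\pi\in\Pi_N}\delta_v(\pi,i)$. Monte Carlo algorithm with $M$ samples: draw $\pi_1,\dots,\pi_M$ independently and uniformly at random from $\Pi_N$ and output $\phi^A_i=\frac1M\sum_{m=1}^M\delta_v(\pi_m,i)$ for each $i\in N$. *)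

theory Defs
  imports "HOL-Probability.Probability"
begin

text \<open>A cooperative game on the player set \<open>N\<close> is given by its characteristic
  function of type \<^typ>\<open>'a set \<Rightarrow> real\<close>, of which only the values on subsets of \<open>N\<close> matter.\<close>

definition bankruptcy_game :: "'a set \<Rightarrow> real \<Rightarrow> ('a \<Rightarrow> real) \<Rightarrow> 'a set \<Rightarrow> real" where
  "bankruptcy_game N E w S = max 0 (E - (\<Sum>i\<in>N - S. w i))"

text \<open>The bijections from \<open>{1..card N}\<close> to \<open>N\<close>. They are taken to be extensional
  (\<open>undefined\<close> outside \<open>{1..card N}\<close>), so that distinct elements are distinct as bijections
  and there are exactly \<open>fact (card N)\<close> of them.\<close>

definition player_perms :: "'a set \<Rightarrow> (nat \<Rightarrow> 'a) set" where
  "player_perms N = {\<pi> \<in> {1..card N} \<rightarrow>\<^sub>E N. bij_betw \<pi> {1..card N} N}"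

definition Prc :: "'a set \<Rightarrow> (nat \<Rightarrow> 'a) \<Rightarrow> 'a \<Rightarrow> 'a set" where
  "Prc N \<pi> i = {\<pi> k |k. k \<in> {1..card N} \<and> (\<exists>l\<in>{1..card N}. \<pi> l = i \<and> k < l)}"

definition marginal_contribution ::
    "'a set \<Rightarrow> ('a set \<Rightarrow> real) \<Rightarrow> (nat \<Rightarrow> 'a) \<Rightarrow> 'a \<Rightarrow> real" where
  "marginal_contribution N v \<pi> i = v (Prc N \<pi> i \<union> {i}) - v (Prc N \<pi> i)"

definition shapley_value :: "'a set \<Rightarrow> ('a set \<Rightarrow> real) \<Rightarrow> 'a \<Rightarrow> real" where
  "shapley_value N v i =
     1 / fact (card N) * (\<Sum>\<pi>\<in>player_perms N. marginal_contribution N v \<pi> i)"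

text \<open>The joint distribution of the output vector. The product distribution \<^const>\<open>Pi_pmf\<close>
  on the index set \<open>{1..M}\<close> makes the samples \<open>\<pi>s 1, \<dots>, \<pi>s M\<close> independent and uniform; its
  second argument is the irrelevant value of \<open>\<pi>s\<close> outside \<open>{1..M}\<close>.\<close>

definition monte_carlo_shapley ::
    "'a set \<Rightarrow> ('a set \<Rightarrow> real) \<Rightarrow> nat \<Rightarrow> ('a \<Rightarrow> real) pmf" where
  "monte_carlo_shapley N v M =
     map_pmf (\<lambda>\<pi>s i. 1 / real M * (\<Sum>m\<in>{1..M}. marginal_contribution N v (\<pi>s m) i))
       (Pi_pmf {1..M} undefined (\<lambda>_. pmf_of_set (player_perms N)))"

end

theory Submission
  imports Defs
begin

text \<open>Every marginal contribution of player \<open>i\<close> lies in \<open>[0, w i]\<close>. Since \<open>w i \<le> E\<close>, it equals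
  \<open>w i\<close> for the orderings that place \<open>i\<close> last, which have probability \<open>1/n\<close>; hence
  \<open>w i / n \<le> \<phi> i\<close>. A relative error \<open>\<epsilon>\<close> is therefore an absolute error of at least
  \<open>\<epsilon> * w i / n\<close>, and in Hoeffding's inequality for variables in \<open>[0, w i]\<close> the factor \<open>w i\<close>
  cancels, leaving the bound \<open>2 * exp (- 2 * M * \<epsilon>\<^sup>2 / n\<^sup>2)\<close>.\<close>

section \<open>Concentration of the mean of independent samples\<close>

lemma Hoeffding_sample_mean_pmf:
  fixes f :: "'a \<Rightarrow> real" and p :: "'a pmf" and a b t :: real
  assumes I: "finite I" "I \<noteq> {}" and ab: "a < b" and t: "t \<ge> 0"
    and f: "\<And>x. x \<in> set_pmf p \<Longrightarrow> f x \<in> {a..b}"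
  shows "measure_pmf.prob (Pi_pmf I d (\<lambda>_. p))
           {h. \<bar>(\<Sum>i\<in>I. f (h i)) / card I - measure_pmf.expectation p f\<bar> \<ge> t}
         \<le> 2 * exp (- 2 * real (card I) * t\<^sup>2 / (b - a)\<^sup>2)"
proof -
  let ?P = "Pi_pmf I d (\<lambda>_. p)"
  obtain j where j: "j \<in> I" using I by blast
  have component: "map_pmf (\<lambda>h. h i) ?P = p" if "i \<in> I" for i
    using I that by (simp add: Pi_pmf_component)
  have distr: "distr (measure_pmf ?P) borel (\<lambda>h. f (h i)) = distr (measure_pmf p) borel f"
    if "i \<in> I" for i
  proof -
    have "distr (measure_pmf ?P) borel (\<lambda>h. f (h i)) =
          distr (measure_pmf (map_pmf (\<lambda>h. h i) ?P)) borel f"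
      unfolding map_pmf_rep_eq by (subst distr_distr) (auto simp: o_def)
    then show ?thesis using component[OF that] by simp
  qed
  have expect: "measure_pmf.expectation ?P (\<lambda>h. f (h j)) = measure_pmf.expectation p f"
    by (subst (2) component[OF j, symmetric]) simp
  \<comment> \<open>The coordinates of the product are independent, and each \<open>f (h i)\<close>
    has the law of \<open>f\<close> under \<open>p\<close>. The index \<open>j\<close> only supplies
    the representative variable that the locale asks for.\<close>
  interpret Hoeffding_ineq_iid "measure_pmf ?P" I "\<lambda>i h. f (h i)" "\<lambda>h. f (h j)" a b
    "measure_pmf.expectation p f"
  proof unfold_locales
    show "prob_space.indep_vars (measure_pmf ?P) (\<lambda>_. borel) (\<lambda>i h. f (h i)) I"
      by (intro prob_space.indep_vars_compose2[OF _ indep_vars_Pi_pmf])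
         (auto simp: measure_pmf.prob_space_axioms I)
  next
    show "AE h in measure_pmf ?P. f (h j) \<in> {a..b}"
    proof (rule AE_pmfI)
      fix h assume "h \<in> set_pmf ?P"
      then have "h j \<in> set_pmf p"
        using j I by (simp add: set_Pi_pmf PiE_dflt_def)
      then show "f (h j) \<in> {a..b}" by (rule f)
    qed
  qed (auto simp: I distr j expect)
  show ?thesis
    using Hoeffding_ineq_abs_ge'[OF t ab I(2)] by simp
qed

section \<open>Counting orderings of the players\<close>

lemma player_perms_eq:
  assumes "finite N"
  shows "player_perms N = {\<pi> \<in> {1..card N} \<rightarrow>\<^sub>E N. inj_on \<pi> {1..card N}}"
proof -
  \<comment> \<open>An injection between finite sets of equal size is onto. This reduces the count
    of orderings to the known count of injections.\<close>
  have "bij_betw \<pi> {1..card N} N"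
    if "\<pi> \<in> {1..card N} \<rightarrow>\<^sub>E N" "inj_on \<pi> {1..card N}" for \<pi>
    unfolding bij_betw_def using that assms
    by (metis PiE_iff card_atLeastAtMost card_image card_subset_eq diff_Suc_1 image_subset_iff)
  then show ?thesis
    by (auto simp: player_perms_def bij_betw_def)
qed

lemma finite_player_perms: "finite N \<Longrightarrow> finite (player_perms N)"
  by (rule finite_subset[of _ "{1..card N} \<rightarrow>\<^sub>E N"]) (auto simp: player_perms_def intro: finite_PiE)

lemma card_player_perms:
  assumes "finite N"
  shows "card (player_perms N) = fact (card N)"
  using card_inj_on_subset_funcset[of "{1..card N}" N "{1..card N}"] assms
  by (simp add: player_perms_eq fact_prod_rev flip: atLeast0LessThan)

lemma player_perms_nonempty: "finite N \<Longrightarrow> player_perms N \<noteq> {}"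
  using card_player_perms[of N] by (metis card.empty fact_nonzero)

text \<open>Appending \<open>i\<close> at position \<open>card N\<close> sends the orderings of
  \<open>N - {i}\<close> injectively to orderings of \<open>N\<close> that end with
  \<open>i\<close>. The inequality suffices for bounding the Shapley value from below.\<close>

lemma card_player_perms_last_ge:
  assumes fin: "finite N" and i: "i \<in> N"
  shows "card {\<pi> \<in> player_perms N. \<pi> (card N) = i} \<ge> fact (card N - 1)"
proof -
  let ?n = "card N"
  let ?h = "\<lambda>\<sigma>. \<sigma>(?n := i)"
  have n: "?n \<ge> 1" using fin i by (metis card_0_eq empty_iff less_one not_le)
  have dom: "{1..?n} = insert ?n {1..?n - 1}" using n by auto
  have cardD: "card (N - {i}) = ?n - 1" using fin i by simp
  have "inj_on ?h (player_perms (N - {i}))"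
  proof (rule inj_onI, rule ext)
    fix \<sigma> \<tau> k
    assume *: "\<sigma> \<in> player_perms (N - {i})" "\<tau> \<in> player_perms (N - {i})" "?h \<sigma> = ?h \<tau>"
    \<comment> \<open>At \<open>?n\<close> the update hides the old values. They agree because both
      orderings are \<open>undefined\<close> outside \<open>{1..?n - 1}\<close>.\<close>
    show "\<sigma> k = \<tau> k"
    proof (cases "k = ?n")
      case True
      then have "k \<notin> {1..?n - 1}" using n by auto
      then show ?thesis using * by (auto simp: player_perms_def cardD PiE_def extensional_def)
    next
      case False
      then show ?thesis using fun_cong[OF *(3), of k] by simp
    qed
  qed
  moreover have "?h ` player_perms (N - {i}) \<subseteq> {\<pi> \<in> player_perms N. \<pi> ?n = i}"
  proof safe
    fix \<sigma> assume \<sigma>: "\<sigma> \<in> player_perms (N - {i})"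
    have "bij_betw (?h \<sigma>) {1..?n - 1} (N - {i})"
      using \<sigma> n by (subst bij_betw_cong[where g = \<sigma>]) (auto simp: player_perms_def cardD)
    then have "bij_betw (?h \<sigma>) ({1..?n - 1} \<union> {?n}) ((N - {i}) \<union> {i})"
      by (rule bij_betw_combine) auto
    moreover have "{1..?n - 1} \<union> {?n} = {1..?n}" "(N - {i}) \<union> {i} = N"
      using dom i by auto
    ultimately have "bij_betw (?h \<sigma>) {1..?n} N" by simp
    moreover have "?h \<sigma> \<in> extensional {1..?n}"
      using \<sigma> n by (auto simp: player_perms_def cardD PiE_def extensional_def)
    ultimately show "?h \<sigma> \<in> player_perms N"
      by (simp add: player_perms_def PiE_def bij_betw_imp_funcset)
  qed simp
  ultimately have "card (player_perms (N - {i})) \<le> card {\<pi> \<in> player_perms N. \<pi> ?n = i}"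
    using finite_player_perms[OF fin] by (intro card_inj_on_le) auto
  then show ?thesis using card_player_perms[of "N - {i}"] fin cardD by simp
qed

text \<open>By injectivity \<open>card N\<close> is the only position of \<open>i\<close>, so every
  other player stands before it.\<close>

lemma Prc_last:
  assumes "\<pi> \<in> player_perms N" "\<pi> (card N) = i" "i \<in> N"
  shows "Prc N \<pi> i = N - {i}"
proof -
  have inj: "inj_on \<pi> {1..card N}" and img: "\<pi> ` {1..card N} = N"
    using assms(1) by (auto simp: player_perms_def bij_betw_def)
  from img assms(3) have n: "card N \<in> {1..card N}" by (cases "card N") auto
  have "k < card N \<longleftrightarrow> \<pi> k \<noteq> i" if "k \<in> {1..card N}" for k
    using that inj_on_eq_iff[OF inj that n] assms(2) by auto
  moreover have "l = card N" if "l \<in> {1..card N}" "\<pi> l = i" for l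
    using that inj_on_eq_iff[OF inj that(1) n] assms(2) by auto
  ultimately have "Prc N \<pi> i = {\<pi> k |k. k \<in> {1..card N} \<and> \<pi> k \<noteq> i}"
    unfolding Prc_def using n assms(2) by blast
  also have "\<dots> = \<pi> ` {1..card N} - {i}" by blast
  finally show ?thesis using img by simp
qed

lemma Prc_irrefl:
  assumes "\<pi> \<in> player_perms N"
  shows "i \<notin> Prc N \<pi> i"
  using assms by (auto simp: Prc_def player_perms_def bij_betw_def dest: inj_onD)

section \<open>Marginal contributions and the Shapley value\<close>

lemma expectation_marginal_contribution:
  assumes "finite N"
  shows "measure_pmf.expectation (pmf_of_set (player_perms N))
           (\<lambda>\<pi>. marginal_contribution N v \<pi> i) = shapley_value N v i"
  using assms
  by (simp add: integral_pmf_of_set player_perms_nonempty finite_player_perms card_player_perms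
      shapley_value_def)

text \<open>When \<open>i\<close> joins, the claims of the outsiders drop by exactly
  \<open>w i\<close>. The map \<open>max 0\<close> is nondecreasing and 1-Lipschitz, so the value
  grows by at least 0 and at most \<open>w i\<close>.\<close>

lemma marginal_contribution_bankruptcy_bounds:
  assumes "finite N" "i \<in> N" "w i \<ge> 0" "\<pi> \<in> player_perms N"
  shows "marginal_contribution N (bankruptcy_game N E w) \<pi> i \<in> {0..w i}"
proof -
  let ?S = "Prc N \<pi> i"
  have "i \<in> N - ?S" using Prc_irrefl[OF assms(4)] assms(2) by simp
  then have "(\<Sum>j\<in>N - ?S. w j) = w i + (\<Sum>j\<in>N - ?S - {i}. w j)"
    using assms(1) by (intro sum.remove) auto
  moreover have "N - (?S \<union> {i}) = N - ?S - {i}" by blast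
  ultimately show ?thesis
    using assms(3) by (simp add: marginal_contribution_def bankruptcy_game_def max_def)
qed

text \<open>Marginal contributions are nonnegative, so dropping the orderings that do not end with
  \<open>i\<close> can only lower the sum. At least \<open>fact (card N - 1)\<close> of the
  \<open>fact (card N)\<close> orderings remain.\<close>

lemma shapley_value_bankruptcy_ge:
  assumes fin: "finite N" and i: "i \<in> N" and w: "0 \<le> w i" "w i \<le> E"
  shows "shapley_value N (bankruptcy_game N E w) i \<ge> w i / card N"
proof -
  let ?m = "\<lambda>\<pi>. marginal_contribution N (bankruptcy_game N E w) \<pi> i"
  let ?L = "{\<pi> \<in> player_perms N. \<pi> (card N) = i}"
  \<comment> \<open>The grand coalition has value \<open>E\<close> and \<open>N - {i}\<close> has
    value \<open>E - w i\<close>; \<open>w i \<le> E\<close> prevents truncation at 0.\<close>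
  have last: "?m \<pi> = w i" if "\<pi> \<in> ?L" for \<pi>
  proof -
    have "Prc N \<pi> i = N - {i}" using that i by (intro Prc_last) auto
    moreover have "N - {i} \<union> {i} = N" "N - (N - {i}) = {i}" using i by auto
    ultimately show ?thesis
      using w by (simp add: marginal_contribution_def bankruptcy_game_def)
  qed
  have "real (fact (card N - 1)) \<le> real (card ?L)"
    using card_player_perms_last_ge[OF fin i] by (rule of_nat_mono)
  then have "fact (card N - 1) * w i \<le> real (card ?L) * w i"
    using w(1) unfolding of_nat_fact by (rule mult_right_mono)
  also have "\<dots> = (\<Sum>\<pi>\<in>?L. ?m \<pi>)"
    using last by simp
  also have "\<dots> \<le> (\<Sum>\<pi>\<in>player_perms N. ?m \<pi>)"
    using marginal_contribution_bankruptcy_bounds[of N i w _ E] fin i w(1)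
    by (intro sum_mono2 finite_player_perms[OF fin]) auto
  finally have "fact (card N - 1) * w i / fact (card N) \<le> shapley_value N (bankruptcy_game N E w) i"
    by (simp add: shapley_value_def divide_right_mono)
  moreover have "fact (card N) = real (card N) * fact (card N - 1)"
    using fin i by (intro fact_reduce) (auto simp: card_gt_0_iff)
  ultimately show ?thesis by simp
qed

section \<open>Mean and deviation of the Monte Carlo estimator\<close>

lemma expectation_monte_carlo_shapley:
  assumes fin: "finite N" and M: "M > 0"
  shows "measure_pmf.expectation (monte_carlo_shapley N v M) (\<lambda>\<phi>A. \<phi>A i) = shapley_value N v i"
proof -
  let ?U = "pmf_of_set (player_perms N)"
  let ?P = "Pi_pmf {1..M} undefined (\<lambda>_. ?U)"
  let ?m = "\<lambda>\<pi>. marginal_contribution N v \<pi> i"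
  \<comment> \<open>Finite support gives the integrability that linearity of expectation
    requires.\<close>
  have "finite (set_pmf ?P)"
    using player_perms_nonempty[OF fin] fin
    by (auto simp: set_Pi_pmf finite_player_perms)
  then have int: "integrable (measure_pmf ?P) g" for g :: "_ \<Rightarrow> real"
    by (rule integrable_measure_pmf_finite)
  \<comment> \<open>Every sample is uniform on the orderings, so each summand alone already has the
    Shapley value as its mean.\<close>
  have comp: "measure_pmf.expectation ?P (\<lambda>h. ?m (h k)) = shapley_value N v i"
    if "k \<in> {1..M}" for k
  proof -
    have "measure_pmf.expectation ?P (\<lambda>h. ?m (h k)) =
          measure_pmf.expectation (map_pmf (\<lambda>h. h k) ?P) ?m" by simp
    also have "map_pmf (\<lambda>h. h k) ?P = ?U" using that by (subst Pi_pmf_component) auto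
    finally show ?thesis by (simp add: expectation_marginal_contribution[OF fin])
  qed
  have "measure_pmf.expectation (monte_carlo_shapley N v M) (\<lambda>\<phi>A. \<phi>A i) =
        measure_pmf.expectation ?P (\<lambda>h. \<Sum>k\<in>{1..M}. ?m (h k)) / M"
    by (simp add: monte_carlo_shapley_def)
  also have "measure_pmf.expectation ?P (\<lambda>h. \<Sum>k\<in>{1..M}. ?m (h k)) =
        (\<Sum>k\<in>{1..M}. measure_pmf.expectation ?P (\<lambda>h. ?m (h k)))"
    by (intro Bochner_Integration.integral_sum int)
  finally show ?thesis
    using comp M by simp
qed

lemma monte_carlo_shapley_deviation:
  fixes b t :: real
  assumes fin: "finite N" and M: "M > 0" and b: "b > 0" and t: "t \<ge> 0"
    and bounds: "\<And>\<pi>. \<pi> \<in> player_perms N \<Longrightarrow> marginal_contribution N v \<pi> i \<in> {0..b}"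
  shows "measure_pmf.prob (monte_carlo_shapley N v M) {\<phi>A. \<bar>\<phi>A i - shapley_value N v i\<bar> \<ge> t}
         \<le> 2 * exp (- 2 * real M * t\<^sup>2 / b\<^sup>2)"
proof -
  let ?U = "pmf_of_set (player_perms N)"
  show ?thesis
    using Hoeffding_sample_mean_pmf[of "{1..M}" 0 b t ?U "\<lambda>\<pi>. marginal_contribution N v \<pi> i" undefined]
      M b t bounds player_perms_nonempty[OF fin] fin
    by (simp add: monte_carlo_shapley_def finite_player_perms expectation_marginal_contribution
        vimage_def)
qed

lemma monte_carlo_bankruptcy_relative_error:
  assumes fin: "finite N" and i: "i \<in> N" and w: "0 < w i" "w i \<le> E" and M: "M > 0" and "\<epsilon> > 0"
  defines "\<phi> \<equiv> shapley_value N (bankruptcy_game N E w)"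
  shows "measure_pmf.prob (monte_carlo_shapley N (bankruptcy_game N E w) M)
           {\<phi>A. \<not> \<bar>\<phi>A i - \<phi> i\<bar> / \<phi> i < \<epsilon>}
         \<le> 2 * exp (- 2 * real M * \<epsilon>\<^sup>2 / (real (card N))\<^sup>2)"
proof -
  let ?A = "monte_carlo_shapley N (bankruptcy_game N E w) M"
  \<comment> \<open>A lower bound for \<open>\<epsilon> * \<phi> i\<close>, chosen so that
    \<open>?t / w i\<close> is \<open>\<epsilon> / card N\<close> and the claim cancels in the
    exponent.\<close>
  let ?t = "\<epsilon> * w i / card N"
  have n: "card N > 0" using fin i by (auto simp: card_gt_0_iff)
  have \<phi>_ge: "w i / card N \<le> \<phi> i"
    unfolding \<phi>_def using shapley_value_bankruptcy_ge[of N i w E] fin i w by simp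
  then have "0 < \<phi> i" using w n by (smt (verit) divide_pos_pos of_nat_0_less_iff)
  have "?t \<le> \<epsilon> * \<phi> i"
    using mult_left_mono[OF \<phi>_ge, of \<epsilon>] \<open>\<epsilon> > 0\<close> by simp
  then have sub: "{\<phi>A. \<not> \<bar>\<phi>A i - \<phi> i\<bar> / \<phi> i < \<epsilon>} \<subseteq> {\<phi>A. \<bar>\<phi>A i - \<phi> i\<bar> \<ge> ?t}"
    using \<open>0 < \<phi> i\<close> by (auto simp: not_less field_simps)
  have "measure_pmf.prob ?A {\<phi>A. \<not> \<bar>\<phi>A i - \<phi> i\<bar> / \<phi> i < \<epsilon>} \<le>
        measure_pmf.prob ?A {\<phi>A. \<bar>\<phi>A i - \<phi> i\<bar> \<ge> ?t}"
    using sub by (intro measure_pmf.finite_measure_mono) auto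
  also have "\<dots> \<le> 2 * exp (- 2 * real M * ?t\<^sup>2 / (w i)\<^sup>2)"
    unfolding \<phi>_def
    using marginal_contribution_bankruptcy_bounds[of N i w _ E] fin i w \<open>\<epsilon> > 0\<close>
    by (intro monte_carlo_shapley_deviation[OF fin M]) auto
  also have "- 2 * real M * ?t\<^sup>2 / (w i)\<^sup>2 = - 2 * real M * \<epsilon>\<^sup>2 / (real (card N))\<^sup>2"
    using w n by (simp add: power_mult_distrib power_divide)
  finally show ?thesis .
qed

text \<open>The sample size pushes the exponent down to \<open>- ln c\<close>. With
  \<open>c = 2 / \<delta>\<close> and \<open>c = 2 * n / \<delta>\<close>, the factor 2 of the
  two-sided tail yields failure probabilities \<delta> and \<open>\<delta> / n\<close>.\<close>

lemma exp_sample_size_le: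
  fixes c \<epsilon> m n :: real
  assumes "n > 0" "\<epsilon> > 0" "c > 0" "m \<ge> n\<^sup>2 * ln c / (2 * \<epsilon>\<^sup>2)"
  shows "exp (- 2 * m * \<epsilon>\<^sup>2 / n\<^sup>2) \<le> 1 / c"
proof -
  have "ln c \<le> 2 * m * \<epsilon>\<^sup>2 / n\<^sup>2"
    using assms by (simp add: field_simps)
  then have "exp (- 2 * m * \<epsilon>\<^sup>2 / n\<^sup>2) \<le> exp (- ln c)" by simp
  then show ?thesis using assms(3) by (simp add: exp_minus inverse_eq_divide)
qed

theorem theorem6p2:
  fixes n M :: nat and E :: real and w :: "nat \<Rightarrow> real"
    and N :: "nat set" and v :: "nat set \<Rightarrow> real"
    and \<phi> :: "nat \<Rightarrow> real" and A :: "(nat \<Rightarrow> real) pmf"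
  assumes N_def: "N = {1..n}"
    and E_rat: "E \<in> \<rat>" and E_pos: "E > 0"
    and w_rat: "\<And>i. i \<in> N \<Longrightarrow> w i \<in> \<rat>" and w_pos: "\<And>i. i \<in> N \<Longrightarrow> w i > 0"
    and E_less: "E < (\<Sum>i\<in>N. w i)"
    and w_le: "\<And>i. i \<in> N \<Longrightarrow> w i \<le> E"
    and v_def: "v = bankruptcy_game N E w"
    and phi_def: "\<phi> = shapley_value N v"
    and M_pos: "M > 0"
    and A_def: "A = monte_carlo_shapley N v M"
  shows "(\<forall>i\<in>N. measure_pmf.expectation A (\<lambda>\<phi>A. \<phi>A i) = \<phi> i) \<and>
    (\<forall>\<epsilon> \<delta> :: real. \<epsilon> > 0 \<and> 0 < \<delta> \<and> \<delta> < 1 \<longrightarrow>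
       (real M \<ge> (real n)\<^sup>2 * ln (2 / \<delta>) / (2 * \<epsilon>\<^sup>2) \<longrightarrow>
          (\<forall>i\<in>N. measure_pmf.prob A {\<phi>A. \<bar>\<phi>A i - \<phi> i\<bar> / \<phi> i < \<epsilon>} \<ge> 1 - \<delta>)) \<and>
       (real M \<ge> (real n)\<^sup>2 * ln (2 * real n / \<delta>) / (2 * \<epsilon>\<^sup>2) \<longrightarrow>
          measure_pmf.prob A {\<phi>A. \<forall>i\<in>N. \<bar>\<phi>A i - \<phi> i\<bar> / \<phi> i < \<epsilon>} \<ge> 1 - \<delta>))"
proof (intro conjI ballI allI impI; (elim conjE)?)
  have fin: "finite N" and card_N: "card N = n" by (simp_all add: N_def)
  show "measure_pmf.expectation A (\<lambda>\<phi>A. \<phi>A i) = \<phi> i" for i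
    unfolding A_def phi_def by (rule expectation_monte_carlo_shapley[OF fin M_pos])
  fix \<epsilon> \<delta> :: real
  assume \<epsilon>: "0 < \<epsilon>" and \<delta>: "0 < \<delta>"
  let ?bad = "\<lambda>i. {\<phi>A. \<not> \<bar>\<phi>A i - \<phi> i\<bar> / \<phi> i < \<epsilon>}"
  have bad: "measure_pmf.prob A (?bad i) \<le> 2 * exp (- 2 * real M * \<epsilon>\<^sup>2 / (real n)\<^sup>2)" if "i \<in> N" for i
    using monte_carlo_bankruptcy_relative_error[of N i w E M \<epsilon>] fin that w_pos[OF that] w_le[OF that] M_pos \<epsilon>
    by (simp add: A_def phi_def v_def card_N)
  \<comment> \<open>Without players the sum of claims would be 0, contradicting \<open>0 < E\<close>
    and \<open>E_less\<close>.\<close>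
  have n: "n > 0"
    using E_pos E_less by (cases n) (auto simp: N_def)
  {
    fix i assume M: "(real n)\<^sup>2 * ln (2 / \<delta>) / (2 * \<epsilon>\<^sup>2) \<le> real M" and i: "i \<in> N"
    have "measure_pmf.prob A (?bad i) \<le> \<delta>"
      using bad[OF i] exp_sample_size_le[OF _ \<epsilon> _ M] n \<delta> by simp
    moreover have "{\<phi>A. \<bar>\<phi>A i - \<phi> i\<bar> / \<phi> i < \<epsilon>} = UNIV - ?bad i" by auto
    ultimately show "1 - \<delta> \<le> measure_pmf.prob A {\<phi>A. \<bar>\<phi>A i - \<phi> i\<bar> / \<phi> i < \<epsilon>}"
      using measure_pmf.prob_compl[of "?bad i" A] by simp
  next
    assume M: "(real n)\<^sup>2 * ln (2 * real n / \<delta>) / (2 * \<epsilon>\<^sup>2) \<le> real M"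
    \<comment> \<open>All players share the same samples, so their errors need not be independent. A
      union bound distributes \<delta> evenly, \<open>\<delta> / n\<close> for each player.\<close>
    have "measure_pmf.prob A (\<Union>i\<in>N. ?bad i) \<le> (\<Sum>i\<in>N. measure_pmf.prob A (?bad i))"
      by (rule measure_pmf.finite_measure_subadditive_finite[OF fin]) auto
    also have "\<dots> \<le> (\<Sum>i\<in>N. \<delta> / n)"
      using bad exp_sample_size_le[OF _ \<epsilon> _ M] n \<delta> by (intro sum_mono) fastforce
    also have "\<dots> = \<delta>" using n card_N by simp
    finally have "measure_pmf.prob A (\<Union>i\<in>N. ?bad i) \<le> \<delta>" .
    moreover have "{\<phi>A. \<forall>i\<in>N. \<bar>\<phi>A i - \<phi> i\<bar> / \<phi> i < \<epsilon>} = UNIV - (\<Union>i\<in>N. ?bad i)" by auto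
    ultimately show "1 - \<delta> \<le> measure_pmf.prob A {\<phi>A. \<forall>i\<in>N. \<bar>\<phi>A i - \<phi> i\<bar> / \<phi> i < \<epsilon>}"
      using measure_pmf.prob_compl[of "\<Union>i\<in>N. ?bad i" A] by simp
  }
qed

end
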